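(* Let $A$ be an MV-algebra. Every prime ideal of $A$ is a quasihyperradical ideal. (That is, MV-chains are quasihyperarchimedean algebras.)
   Context: In an MV-algebra $(A,\oplus,\neg,0)$ put $1=\neg 0$, $x\odot y=\neg(\neg x\oplus\neg y)$, $x\ominus y=x\odot\neg y$, $x\le y$ iff $x\ominus y=0$, and $na=a\oplus\cdots\oplus a$ ($n$ times, $0a=0$). An ideal is a subset containing $0$, closed under $\oplus$ and downward closed. An ideal $I$ is prime if it is proper and for all $x,y\in A$, $x\ominus y\in I$ or $y\ominus x\in I$. For an ideal $I\subset A$: $\sqrt{I}=\{a\in A\mid na\ominus\neg a\in I\text{ for each integer }n\ge 0\}$. $I$ is quasihyperradical if for any $x\in A$ there is an integer $n\ge 1$ such that $(n+1)x\ominus nx\in\sqrt{I}$. $A$ is a chain (nontrivial and totally ordered) iff its ideal $\{0\}$ is prime; $A$ is quasihyperarchimedean if its ideal $\{0\}$ is quasihyperradical. *)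

theory Defs
  imports "HOL-Algebra.Congruence"
begin

record 'a mv_struct = "'a partial_object" +
  mv_add  :: "['a, 'a] \<Rightarrow> 'a" (infixl "\<oplus>\<index>" 65)
  mv_neg  :: "'a \<Rightarrow> 'a" ("\<sim>\<index> _" [81] 80)
  mv_zero :: 'a ("\<zero>\<index>")

locale mv_algebra =
  fixes A (structure)
  assumes add_closed: "\<lbrakk>x \<in> carrier A; y \<in> carrier A\<rbrakk> \<Longrightarrow> x \<oplus> y \<in> carrier A"
    and neg_closed: "x \<in> carrier A \<Longrightarrow> \<sim> x \<in> carrier A"
    and zero_closed: "\<zero> \<in> carrier A"
    and add_assoc: "\<lbrakk>x \<in> carrier A; y \<in> carrier A; z \<in> carrier A\<rbrakk>
      \<Longrightarrow> (x \<oplus> y) \<oplus> z = x \<oplus> (y \<oplus> z)"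
    and add_comm: "\<lbrakk>x \<in> carrier A; y \<in> carrier A\<rbrakk> \<Longrightarrow> x \<oplus> y = y \<oplus> x"
    and add_zero: "x \<in> carrier A \<Longrightarrow> x \<oplus> \<zero> = x"
    and neg_neg: "x \<in> carrier A \<Longrightarrow> \<sim> (\<sim> x) = x"
    and add_neg_zero: "x \<in> carrier A \<Longrightarrow> x \<oplus> \<sim> \<zero> = \<sim> \<zero>"
    and mv_axiom: "\<lbrakk>x \<in> carrier A; y \<in> carrier A\<rbrakk>
      \<Longrightarrow> \<sim> (\<sim> x \<oplus> y) \<oplus> y = \<sim> (\<sim> y \<oplus> x) \<oplus> x"

definition mv_one :: "('a, 'm) mv_struct_scheme \<Rightarrow> 'a" ("\<one>\<index>") where
  "\<one>\<^bsub>A\<^esub> = \<sim>\<^bsub>A\<^esub> \<zero>\<^bsub>A\<^esub>"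

definition mv_odot :: "('a, 'm) mv_struct_scheme \<Rightarrow> 'a \<Rightarrow> 'a \<Rightarrow> 'a"
    (infixl "\<odot>\<index>" 70) where
  "x \<odot>\<^bsub>A\<^esub> y = \<sim>\<^bsub>A\<^esub> (\<sim>\<^bsub>A\<^esub> x \<oplus>\<^bsub>A\<^esub> \<sim>\<^bsub>A\<^esub> y)"

definition mv_minus :: "('a, 'm) mv_struct_scheme \<Rightarrow> 'a \<Rightarrow> 'a \<Rightarrow> 'a"
    (infixl "\<ominus>\<index>" 65) where
  "x \<ominus>\<^bsub>A\<^esub> y = x \<odot>\<^bsub>A\<^esub> \<sim>\<^bsub>A\<^esub> y"

definition mv_le :: "('a, 'm) mv_struct_scheme \<Rightarrow> 'a \<Rightarrow> 'a \<Rightarrow> bool"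
    (infix "\<preceq>\<index>" 50) where
  "x \<preceq>\<^bsub>A\<^esub> y \<longleftrightarrow> x \<ominus>\<^bsub>A\<^esub> y = \<zero>\<^bsub>A\<^esub>"

primrec mv_nmult :: "('a, 'm) mv_struct_scheme \<Rightarrow> nat \<Rightarrow> 'a \<Rightarrow> 'a" where
  "mv_nmult A 0 a = \<zero>\<^bsub>A\<^esub>"
| "mv_nmult A (Suc n) a = mv_nmult A n a \<oplus>\<^bsub>A\<^esub> a"

definition mv_ideal :: "('a, 'm) mv_struct_scheme \<Rightarrow> 'a set \<Rightarrow> bool" where
  "mv_ideal A I \<longleftrightarrow> I \<subseteq> carrier A \<and> \<zero>\<^bsub>A\<^esub> \<in> I
     \<and> (\<forall>x\<in>I. \<forall>y\<in>I. x \<oplus>\<^bsub>A\<^esub> y \<in> I)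
     \<and> (\<forall>x\<in>carrier A. \<forall>y\<in>I. x \<preceq>\<^bsub>A\<^esub> y \<longrightarrow> x \<in> I)"

definition mv_prime_ideal :: "('a, 'm) mv_struct_scheme \<Rightarrow> 'a set \<Rightarrow> bool" where
  "mv_prime_ideal A I \<longleftrightarrow> mv_ideal A I \<and> I \<noteq> carrier A
     \<and> (\<forall>x\<in>carrier A. \<forall>y\<in>carrier A. x \<ominus>\<^bsub>A\<^esub> y \<in> I \<or> y \<ominus>\<^bsub>A\<^esub> x \<in> I)"

definition mv_sqrt :: "('a, 'm) mv_struct_scheme \<Rightarrow> 'a set \<Rightarrow> 'a set" where
  "mv_sqrt A I = {a \<in> carrier A. \<forall>n. mv_nmult A n a \<ominus>\<^bsub>A\<^esub> \<sim>\<^bsub>A\<^esub> a \<in> I}"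

definition mv_quasihyperradical :: "('a, 'm) mv_struct_scheme \<Rightarrow> 'a set \<Rightarrow> bool" where
  "mv_quasihyperradical A I \<longleftrightarrow> mv_ideal A I
     \<and> (\<forall>x\<in>carrier A. \<exists>n\<ge>1. mv_nmult A (n + 1) x \<ominus>\<^bsub>A\<^esub> mv_nmult A n x \<in> mv_sqrt A I)"

definition mv_chain :: "('a, 'm) mv_struct_scheme \<Rightarrow> bool" where
  "mv_chain A \<longleftrightarrow> \<zero>\<^bsub>A\<^esub> \<noteq> \<one>\<^bsub>A\<^esub>
     \<and> (\<forall>x\<in>carrier A. \<forall>y\<in>carrier A. x \<preceq>\<^bsub>A\<^esub> y \<or> y \<preceq>\<^bsub>A\<^esub> x)"

definition mv_quasihyperarchimedean :: "('a, 'm) mv_struct_scheme \<Rightarrow> bool" where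
  "mv_quasihyperarchimedean A \<longleftrightarrow> mv_quasihyperradical A {\<zero>\<^bsub>A\<^esub>}"

end

theory Submission
  imports Defs
begin

text \<open>Since \<open>na \<ominus> \<sim>a = na \<odot> a\<close>, an element outside \<open>sqrt P\<close> has some \<open>nx \<odot> x = x \<ominus> \<sim>(nx)\<close>
  outside \<open>P\<close>, so primality puts \<open>\<sim>(nx) \<ominus> x = \<sim>((n+1)x)\<close> into \<open>P\<close>; this element dominates
  \<open>(n+2)x \<ominus> (n+1)x\<close>. An element of \<open>sqrt P\<close> dominates \<open>2x \<ominus> x\<close>, and \<open>sqrt P\<close> is downward closed.\<close>

context mv_algebra
begin

lemma one_closed: "\<one> \<in> carrier A"
  by (simp add: mv_one_def neg_closed zero_closed)

lemma odot_closed: "\<lbrakk>x \<in> carrier A; y \<in> carrier A\<rbrakk> \<Longrightarrow> x \<odot> y \<in> carrier A"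
  by (simp add: mv_odot_def neg_closed add_closed)

lemma minus_closed: "\<lbrakk>x \<in> carrier A; y \<in> carrier A\<rbrakk> \<Longrightarrow> x \<ominus> y \<in> carrier A"
  by (simp add: mv_minus_def neg_closed odot_closed)

lemma nmult_closed: "x \<in> carrier A \<Longrightarrow> mv_nmult A n x \<in> carrier A"
  by (induction n) (simp_all add: zero_closed add_closed)

lemmas closed = add_closed neg_closed zero_closed one_closed odot_closed minus_closed nmult_closed

lemma neg_one: "\<sim> \<one> = \<zero>"
  by (simp add: mv_one_def neg_neg zero_closed)

lemma zero_add: "x \<in> carrier A \<Longrightarrow> \<zero> \<oplus> x = x"
  using add_comm[of x \<zero>] by (simp add: add_zero zero_closed)

lemma add_one: "x \<in> carrier A \<Longrightarrow> x \<oplus> \<one> = \<one>"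
  by (simp add: mv_one_def add_neg_zero)

lemma one_add: "x \<in> carrier A \<Longrightarrow> \<one> \<oplus> x = \<one>"
  using add_comm[of x \<one>] by (simp add: add_one one_closed)

lemma odot_comm: "\<lbrakk>x \<in> carrier A; y \<in> carrier A\<rbrakk> \<Longrightarrow> x \<odot> y = y \<odot> x"
  by (simp add: mv_odot_def add_comm[of "\<sim> x"] neg_closed)

lemma neg_add_self: "x \<in> carrier A \<Longrightarrow> \<sim> x \<oplus> x = \<one>"
  using mv_axiom[of x \<one>]
  by (simp add: closed add_one neg_one zero_add)

text \<open>Unfolded, \<open>x \<ominus> y\<close> is \<open>\<sim> (\<sim> x \<oplus> y)\<close> up
  to a double negation, and negation is an involution exchanging \<zero> and \<one>. This form turns
  order facts into computations with \<oplus>.\<close>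

lemma le_iff: "\<lbrakk>x \<in> carrier A; y \<in> carrier A\<rbrakk> \<Longrightarrow> x \<preceq> y \<longleftrightarrow> \<sim> x \<oplus> y = \<one>"
  unfolding mv_le_def mv_minus_def mv_odot_def
  by (metis add_closed mv_one_def neg_closed neg_neg zero_closed)

lemma le_add: "\<lbrakk>x \<in> carrier A; z \<in> carrier A\<rbrakk> \<Longrightarrow> x \<preceq> x \<oplus> z"
  by (simp add: le_iff closed neg_add_self one_add flip: add_assoc)

text \<open>The two sides of \<open>mv_axiom\<close> are two expressions for the join of
  \<open>x\<close> and \<open>y\<close>; when \<open>x \<preceq> y\<close> the first is
  \<open>y\<close>. With \<open>le_add\<close>, this makes \<preceq> the order of being a summand,
  so transitivity and monotonicity follow by regrouping sums.\<close>

lemma le_add_minus: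
  assumes "x \<in> carrier A" "y \<in> carrier A" "x \<preceq> y"
  shows "y = x \<oplus> (y \<ominus> x)"
proof -
  have "y = \<sim> (\<sim> x \<oplus> y) \<oplus> y"
    using assms by (simp add: le_iff neg_one zero_add)
  also have "\<dots> = \<sim> (\<sim> y \<oplus> x) \<oplus> x"
    using assms by (rule_tac mv_axiom)
  also have "\<dots> = x \<oplus> (y \<ominus> x)"
    using assms by (simp add: mv_minus_def mv_odot_def neg_neg add_comm closed)
  finally show ?thesis .
qed

lemma le_trans:
  assumes "x \<in> carrier A" "y \<in> carrier A" "z \<in> carrier A" "x \<preceq> y" "y \<preceq> z"
  shows "x \<preceq> z"
proof -
  have "z = x \<oplus> ((y \<ominus> x) \<oplus> (z \<ominus> y))"
    using le_add_minus[of x y] le_add_minus[of y z] assms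
    by (metis add_assoc minus_closed)
  then show ?thesis
    using assms le_add by (metis add_closed minus_closed)
qed

lemma add_right_mono:
  assumes "x \<in> carrier A" "y \<in> carrier A" "z \<in> carrier A" "x \<preceq> y"
  shows "x \<oplus> z \<preceq> y \<oplus> z"
proof -
  have "y \<oplus> z = (x \<oplus> z) \<oplus> (y \<ominus> x)"
    using le_add_minus[of x y] assms
    by (metis add_assoc add_comm minus_closed)
  then show ?thesis
    using assms by (simp add: le_add closed)
qed

lemma add_mono:
  assumes "x \<in> carrier A" "y \<in> carrier A" "u \<in> carrier A" "v \<in> carrier A" "x \<preceq> y" "u \<preceq> v"
  shows "x \<oplus> u \<preceq> y \<oplus> v"
proof (rule le_trans)
  show "x \<oplus> u \<preceq> y \<oplus> u"
    using assms by (simp add: add_right_mono)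
  show "y \<oplus> u \<preceq> y \<oplus> v"
    using add_right_mono[of u v y] assms by (simp add: add_comm)
qed (simp_all add: assms closed)

lemma neg_antimono:
  "\<lbrakk>x \<in> carrier A; y \<in> carrier A; x \<preceq> y\<rbrakk> \<Longrightarrow> \<sim> y \<preceq> \<sim> x"
  by (simp add: le_iff closed neg_neg add_comm)

text \<open>\<odot> is the De Morgan dual of \<oplus>, so two order reversals surround
  \<open>add_mono\<close>.\<close>

lemma odot_mono:
  assumes "x \<in> carrier A" "y \<in> carrier A" "u \<in> carrier A" "v \<in> carrier A" "x \<preceq> y" "u \<preceq> v"
  shows "x \<odot> u \<preceq> y \<odot> v"
  unfolding mv_odot_def using assms by (simp add: neg_antimono add_mono closed)

lemma odot_le: "\<lbrakk>x \<in> carrier A; y \<in> carrier A\<rbrakk> \<Longrightarrow> x \<odot> y \<preceq> x"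
  using neg_antimono[OF _ _ le_add[of "\<sim> x" "\<sim> y"]]
  by (simp add: mv_odot_def neg_neg closed)

lemma nmult_mono:
  "\<lbrakk>x \<in> carrier A; y \<in> carrier A; x \<preceq> y\<rbrakk> \<Longrightarrow> mv_nmult A n x \<preceq> mv_nmult A n y"
  by (induction n) (simp_all add: add_mono closed le_iff[of \<zero> \<zero>] neg_add_self)

text \<open>An instance of the adjunction by which \<open>z \<ominus> y \<preceq> x\<close> iff
  \<open>z \<preceq> y \<oplus> x\<close>, taken at \<open>z = y \<oplus> x\<close>.\<close>

lemma add_minus_le:
  assumes "x \<in> carrier A" "y \<in> carrier A"
  shows "(y \<oplus> x) \<ominus> y \<preceq> x"
proof -
  have "\<sim> ((y \<oplus> x) \<ominus> y) \<oplus> x = \<sim> (y \<oplus> x) \<oplus> (y \<oplus> x)"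
    using assms by (simp add: mv_minus_def mv_odot_def neg_neg closed add_assoc)
  then show ?thesis
    using assms by (simp add: le_iff closed neg_add_self)
qed

lemma minus_le_neg: "\<lbrakk>x \<in> carrier A; y \<in> carrier A\<rbrakk> \<Longrightarrow> x \<ominus> y \<preceq> \<sim> y"
  using odot_le[of "\<sim> y" x] by (simp add: mv_minus_def odot_comm[of x] closed)

lemma ideal_downward:
  "\<lbrakk>mv_ideal A I; y \<in> I; x \<in> carrier A; x \<preceq> y\<rbrakk> \<Longrightarrow> x \<in> I"
  by (auto simp: mv_ideal_def)

text \<open>Cancelling the double negation leaves a condition built from operations monotone in
  \<open>a\<close>, which is what makes the radical downward closed.\<close>

lemma mem_sqrt_iff:
  "a \<in> mv_sqrt A I \<longleftrightarrow> a \<in> carrier A \<and> (\<forall>n. mv_nmult A n a \<odot> a \<in> I)"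
  by (auto simp: mv_sqrt_def mv_minus_def neg_neg)

lemma sqrt_downward:
  assumes "mv_ideal A I" "b \<in> mv_sqrt A I" "a \<in> carrier A" "a \<preceq> b"
  shows "a \<in> mv_sqrt A I"
proof -
  have b: "b \<in> carrier A" "\<And>n. mv_nmult A n b \<odot> b \<in> I"
    using assms(2) by (simp_all add: mem_sqrt_iff)
  have "mv_nmult A n a \<odot> a \<preceq> mv_nmult A n b \<odot> b" for n
    using assms b by (intro odot_mono nmult_mono nmult_closed)
  then have "mv_nmult A n a \<odot> a \<in> I" for n
    using ideal_downward[OF assms(1) b(2)[of n]] assms(3) odot_closed nmult_closed by simp
  then show ?thesis
    using assms(3) by (simp add: mem_sqrt_iff)
qed

text \<open>Each product \<open>mv_nmult A n a \<odot> a\<close> lies below its factor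
  \<open>a\<close>.\<close>

lemma ideal_subset_sqrt:
  assumes "mv_ideal A I"
  shows "I \<subseteq> mv_sqrt A I"
proof
  fix a assume a: "a \<in> I"
  then have "a \<in> carrier A"
    using assms by (auto simp: mv_ideal_def)
  then show "a \<in> mv_sqrt A I"
    using odot_le[of a "mv_nmult A n a" for n] ideal_downward[OF assms a]
    by (simp add: mem_sqrt_iff closed odot_comm[of _ a])
qed

lemma prime_imp_quasihyperradical:
  assumes P: "mv_prime_ideal A P"
  shows "mv_quasihyperradical A P"
proof -
  have I: "mv_ideal A P"
    using P by (simp add: mv_prime_ideal_def)
  have "\<exists>n\<ge>1. mv_nmult A (n + 1) x \<ominus> mv_nmult A n x \<in> mv_sqrt A P"
    if x: "x \<in> carrier A" for x
  proof (cases "x \<in> mv_sqrt A P")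
    case True
    \<comment> \<open>The witness is 1, the least one allowed, since \<open>x\<close> itself already
      bounds this difference.\<close>
    have "mv_nmult A (1 + 1) x \<ominus> mv_nmult A 1 x \<preceq> x"
      using x by (simp add: add_minus_le zero_add)
    then have "mv_nmult A (1 + 1) x \<ominus> mv_nmult A 1 x \<in> mv_sqrt A P"
      using x by (intro sqrt_downward[OF I True] minus_closed nmult_closed)
    then show ?thesis by blast
  next
    case False
    then obtain n where n: "mv_nmult A n x \<odot> x \<notin> P"
      using x by (auto simp: mem_sqrt_iff)
    have "mv_nmult A n x \<odot> x = x \<ominus> \<sim> (mv_nmult A n x)"
      using x by (simp add: mv_minus_def neg_neg closed odot_comm)
    with n P x have "\<sim> (mv_nmult A n x) \<ominus> x \<in> P"
      unfolding mv_prime_ideal_def by (metis neg_closed nmult_closed)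
    \<comment> \<open>Subtracting \<open>x\<close> from a negation adds \<open>x\<close> under the
      negation: \<open>\<sim> u \<ominus> x = \<sim> (u \<oplus> x)\<close>, here with
      \<open>u = mv_nmult A n x\<close>.\<close>
    then have "\<sim> (mv_nmult A (n + 1) x) \<in> P"
      using x by (simp add: mv_minus_def mv_odot_def neg_neg closed)
    then have "mv_nmult A (n + 1 + 1) x \<ominus> mv_nmult A (n + 1) x \<in> P"
      by (rule ideal_downward[OF I _ minus_closed minus_le_neg]) (intro nmult_closed x)+
    then show ?thesis
      using ideal_subset_sqrt[OF I] by (intro exI[of _ "n + 1"]) auto
  qed
  then show ?thesis
    using I by (simp add: mv_quasihyperradical_def)
qed

lemma le_zero: "\<lbrakk>x \<in> carrier A; x \<preceq> \<zero>\<rbrakk> \<Longrightarrow> x = \<zero>"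
  using neg_neg[of x] by (simp add: le_iff closed add_zero neg_one)

text \<open>Totality is primality of {\<zero>} once \<preceq> is unfolded; nontriviality gives
  properness, because \<one> lies outside {\<zero>}. Downward closure is
  \<open>le_zero\<close>.\<close>

lemma chain_imp_zero_prime:
  assumes "mv_chain A"
  shows "mv_prime_ideal A {\<zero>}"
proof -
  have "{\<zero>} \<noteq> carrier A"
    using assms one_closed unfolding mv_chain_def by (metis singletonD)
  then show ?thesis
    using assms le_zero
    by (auto simp: mv_chain_def mv_prime_ideal_def mv_ideal_def mv_le_def zero_closed add_zero)
qed

end

theorem proposition4p11:
  fixes A :: "('a, 'm) mv_struct_scheme"
  assumes "mv_algebra A"
  shows "(\<forall>P. mv_prime_ideal A P \<longrightarrow> mv_quasihyperradical A P)
    \<and> (mv_chain A \<longrightarrow> mv_quasihyperarchimedean A)"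
proof -
  interpret mv_algebra A by (fact assms)
  show ?thesis
    using prime_imp_quasihyperradical chain_imp_zero_prime
    by (auto simp: mv_quasihyperarchimedean_def)
qed

end
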